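(* Let $n$ be an even positive integer and $k$ an integer with $1 \le k \le n-1$. If a positive divisor $d$ of $n$ satisfies $\gcd(k, n/d) > 1$, then $\alpha^k_d = 0$ and $\beta^k_d = 0$.
   Context: For a permutation $A = a_1\cdots a_n$ of $[n]=\{1,\dots,n\}$, an ascent is an index $i$ with $a_i<a_{i+1}$; $A$ is even/odd according to the parity of its number of inversions (pairs $i<j$ with $a_i>a_j$). A permutation is parity-alternate (a PAP) if its consecutive entries alternate between even and odd integers. The operator $\sigma$ on permutations of $[n]$ is defined as follows: (i) if $a_i = n$ for some $2\le i\le n-1$, then $\sigma(a_1\cdots a_n) = b_1\cdots b_n$ with $b_j = a_j+1$ for $a_j<n$ and $b_i = 1$; (ii) $\sigma(a_1\cdots a_{n-1}n) = 1\,(a_1+1)\cdots(a_{n-1}+1)$; (iii) $\sigma(n\,a_1\cdots a_{n-1}) = (a_1+1)\cdots(a_{n-1}+1)\,1$. $\sigma^\ell$ denotes $\ell$-fold iteration. For $n$ even, call a PAP $A = a_1\cdots a_{n-1}n$ of $[n]$ with $k$ ascents and last entry $n$ a canonical PAP with $k$ ascents, and define $\tau A = \sigma^{\,n-a_{n-1}}A$; $\tau$ maps canonical PAPs with $k$ ascents to canonical PAPs with $k$ ascents of the same parity, and $\tau^n A = A$. Let $\alpha^k_d$ be the number of orbits of size (period) $d$ of $\tau$ acting on the set of even canonical PAPs of $[n]$ with $k$ ascents, and $\beta^k_d$ the number of orbits of size $d$ of $\tau$ acting on the set of odd canonical PAPs of $[n]$ with $k$ ascents. *)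

theory Defs
  imports
    Complex_Main
    "HOL-Combinatorics.Multiset_Permutations"
    "HOL-Combinatorics.Orbits"
begin

text \<open>
  A permutation $a_1 \cdots a_n$ of $\{1,\dots,n\}$ is a list in
  \<^term>\<open>permutations_of_set {1..n::nat}\<close>; list positions are 0-based, so $a_i$ is the list
  element at position $i - 1$.
\<close>

definition ascents :: "nat list \<Rightarrow> nat" where
  "ascents A = card {i. Suc i < length A \<and> A ! i < A ! Suc i}"

definition inversions :: "nat list \<Rightarrow> nat" where
  "inversions A = card {(i, j). i < j \<and> j < length A \<and> A ! i > A ! j}"

definition parity_alternate :: "nat list \<Rightarrow> bool" where
  "parity_alternate A \<longleftrightarrow> (\<forall>i. Suc i < length A \<longrightarrow> even (A ! i) \<noteq> even (A ! Suc i))"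

text \<open>
  The three branches are the cases that the maximum $n$ is the last, the first, or an inner entry.
  They are mutually exclusive for $n \ge 2$.
\<close>

definition \<sigma> :: "nat list \<Rightarrow> nat list" where
  "\<sigma> A = (let n = length A in
     if last A = n then 1 # map Suc (butlast A)
     else if hd A = n then map Suc (tl A) @ [1]
     else map (\<lambda>a. if a < n then a + 1 else 1) A)"

text \<open>The element at position $n - 2$ below is the next-to-last entry $a_{n-1}$.\<close>

definition \<tau> :: "nat list \<Rightarrow> nat list" where
  "\<tau> A = (let n = length A in (\<sigma> ^^ (n - A ! (n - 2))) A)"

definition canonical_PAPs :: "nat \<Rightarrow> nat \<Rightarrow> nat list set" where
  "canonical_PAPs n k =
     {A \<in> permutations_of_set {1..n}. parity_alternate A \<and> last A = n \<and> ascents A = k}"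

definition even_canonical_PAPs :: "nat \<Rightarrow> nat \<Rightarrow> nat list set" where
  "even_canonical_PAPs n k = {A \<in> canonical_PAPs n k. even (inversions A)}"

definition odd_canonical_PAPs :: "nat \<Rightarrow> nat \<Rightarrow> nat list set" where
  "odd_canonical_PAPs n k = {A \<in> canonical_PAPs n k. odd (inversions A)}"

text \<open>
  \<^term>\<open>orbit f x\<close> consists of the iterates $f^m(x)$ with $m \ge 1$; since $\tau^n A = A$ for
  canonical PAPs (with $n$ even), it contains $A$ itself and is the usual orbit.
\<close>

definition \<alpha> :: "nat \<Rightarrow> nat \<Rightarrow> nat \<Rightarrow> nat" where
  "\<alpha> n k d = card {X \<in> orbit \<tau> ` even_canonical_PAPs n k. card X = d}"

definition \<beta> :: "nat \<Rightarrow> nat \<Rightarrow> nat \<Rightarrow> nat" where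
  "\<beta> n k d = card {X \<in> orbit \<tau> ` odd_canonical_PAPs n k. card X = d}"

end

(*
  On canonical permutations \<tau> is the rotation of the cyclic word a_1 ... a_n by one place, followed by
  the translation modulo n that makes the last entry n again. Hence \<tau>^d A = A says that the cyclic
  word of the differences a_(i+1) - a_i modulo n has period d. Taking these differences in {0..<n},
  they add up to n times the number n - k of cyclic descents, so d consecutive ones add up to
  d (n - k). If g = gcd(k, n/d) > 1, then n/g consecutive differences add up to (n - k)/g * n,
  a multiple of n, so two different entries of A would coincide.
*)
theory Submission
  imports Defs "HOL-Number_Theory.Cong"
begin

section \<open>Iterates of \<open>\<sigma>\<close> as translations modulo \<open>n\<close>\<close>

text \<open>Addition modulo \<open>n\<close> with representatives 1 to \<open>n\<close>; for
  \<open>x\<close> and \<open>m\<close> at most \<open>n\<close>, one subtraction suffices.\<close>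

definition shift :: "nat \<Rightarrow> nat \<Rightarrow> nat \<Rightarrow> nat" where
  "shift n m x = (if x + m \<le> n then x + m else x + m - n)"

text \<open>The domain for the study of \<open>\<tau>\<close>: it contains the canonical PAPs for
  every \<open>k\<close>, and for \<open>n \<ge> 2\<close> it is closed under
  \<open>\<tau>\<close>.\<close>

definition perms_max_last :: "nat \<Rightarrow> nat list set" where
  "perms_max_last n = {A \<in> permutations_of_set {1..n}. last A = n}"

definition cyc_nth :: "'a list \<Rightarrow> nat \<Rightarrow> 'a" where
  "cyc_nth A i = A ! (i mod length A)"

lemma perms_max_lastD:
  assumes "A \<in> perms_max_last n"
  shows "length A = n" "distinct A" "set A = {1..n}" "last A = n"
proof -
  show *: "distinct A" "set A = {1..n}" "last A = n"
    using assms by (auto simp: perms_max_last_def permutations_of_set_def)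
  show "length A = n" using distinct_card[OF *(1)] *(2) by simp
qed

text \<open>Written so that the right-hand side is the inner branch of \<open>\<sigma>\<close>
  applied to \<open>shift n m x\<close>.\<close>

lemma shift_Suc:
  assumes "1 \<le> x" "x \<le> n" "m < n"
  shows "shift n (Suc m) x = (if shift n m x < n then shift n m x + 1 else 1)"
  using assms by (auto simp: shift_def)

lemma shift_cong: "[int (shift n m x) = int x + int m] (mod int n)"
proof (cases "x + m \<le> n")
  case False
  then have "int (shift n m x) = int x + int m - int n" by (simp add: shift_def)
  then show ?thesis by (simp add: cong_iff_dvd_diff)
qed (simp add: shift_def)

lemma inj_on_shift: "m < n \<Longrightarrow> inj_on (shift n m) {1..n}"
  by (auto simp: inj_on_def shift_def split: if_splits)

lemma shift_in: "\<lbrakk>x \<in> {1..n}; m \<le> n\<rbrakk> \<Longrightarrow> shift n m x \<in> {1..n}"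
  by (auto simp: shift_def)

text \<open>
  The maximum is last only before the first of these steps, and never first: the first entry is
  m after m steps. So all later steps add 1 modulo n to every entry.
\<close>

lemma funpow_\<sigma>:
  assumes A: "A \<in> perms_max_last n" and n: "n \<ge> 2"
    and "1 \<le> m" "m \<le> n - A ! (n - 2)"
  shows "(\<sigma> ^^ m) A = map (shift n m) (n # butlast A)"
proof -
  note D = perms_max_lastD[OF A]
  have ne: "A \<noteq> []" using D n by auto
  then have split: "butlast A @ [n] = A" using D(4) by (metis append_butlast_last_id)
  then have "distinct (butlast A @ [n])" using D(2) by simp
  then have notin: "n \<notin> set (butlast A)" by simp
  have sub: "set (butlast A) \<subseteq> {1..n}" using D(3) by (metis in_set_butlastD subsetI)
  show ?thesis
    using assms(3,4)
  proof (induction m rule: dec_induct)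
    case base
    \<comment> \<open>The maximum is last here; the 1 that \<open>\<sigma>\<close> puts in front is
      \<open>shift n 1 n\<close>, hence the list \<open>n # butlast A\<close>.\<close>
    have "map (shift n 1) (butlast A) = map Suc (butlast A)"
    proof (rule map_cong[OF refl])
      fix x assume "x \<in> set (butlast A)"
      then have "x \<noteq> n" "x \<le> n" using notin sub by auto
      then show "shift n 1 x = Suc x" by (simp add: shift_def)
    qed
    then show ?case using D n by (simp add: \<sigma>_def shift_def)
  next
    case (step m)
    let ?L = "n # butlast A"
    have a: "A ! (n - 2) \<in> {1..n}" using D n by (metis diff_less nth_mem pos2 order_less_le_trans)
    have len: "length ?L = n" using D n by simp
    have ne: "butlast A \<noteq> []" using D n by (cases A rule: rev_cases) auto
    have "last ?L = butlast A ! (n - 2)" using ne D n by (simp add: last_conv_nth numeral_2_eq_2)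
    also have "\<dots> = A ! (n - 2)" using D n by (simp add: nth_butlast)
    finally have last: "last (map (shift n m) ?L) = shift n m (A ! (n - 2))"
      using ne by (simp add: last_map)
    \<comment> \<open>The last entry is \<open>A ! (n - 2) + m\<close>, not yet reduced, and
      \<open>m < n - A ! (n - 2)\<close>.\<close>
    have l: "last (map (shift n m) ?L) \<noteq> n" unfolding last using step a by (auto simp: shift_def)
    have h: "hd (map (shift n m) ?L) \<noteq> n" using step a n by (auto simp: shift_def)
    have lenm: "length (map (shift n m) ?L) = n" using len by simp
    have "(\<sigma> ^^ Suc m) A = \<sigma> (map (shift n m) ?L)" using step by simp
    also have "\<dots> = map (\<lambda>a. if a < n then a + 1 else 1) (map (shift n m) ?L)"
      unfolding \<sigma>_def Let_def lenm using l h by presburger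
    also have "\<dots> = map (shift n (Suc m)) ?L"
      unfolding map_map
    proof (rule map_cong[OF refl])
      fix x assume "x \<in> set ?L"
      then have "1 \<le> x" "x \<le> n" using sub n by auto
      moreover have "m < n" using step a by auto
      ultimately show "((\<lambda>a. if a < n then a + 1 else 1) \<circ> shift n m) x = shift n (Suc m) x"
        by (simp add: shift_Suc)
    qed
    finally show ?case .
  qed
qed

section \<open>Powers of \<open>\<tau>\<close> on cyclic words, and orbit sizes\<close>

text \<open>\<open>n # butlast A\<close> is \<open>A\<close> rotated one place to the right; it ends
  in \<open>A ! (n - 2)\<close>, and the translation by \<open>n - A ! (n - 2)\<close> turns that
  entry into \<open>n\<close>.\<close>

lemma \<tau>_props:
  assumes A: "A \<in> perms_max_last n" and n: "n \<ge> 2"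
  shows \<tau>_in_perms_max_last: "\<tau> A \<in> perms_max_last n"
    and cyc_nth_\<tau>: "[int (cyc_nth (\<tau> A) (Suc i)) = int (cyc_nth A i) - int (A ! (n - 2))] (mod int n)"
proof -
  note D = perms_max_lastD[OF A]
  define a where "a = A ! (n - 2)"
  let ?L = "n # butlast A"
  have ne: "A \<noteq> []" using D n by auto
  then have split: "butlast A @ [n] = A" using D(4) by (metis append_butlast_last_id)
  have dL: "distinct ?L" and sL: "set ?L = {1..n}"
    using D(2,3) arg_cong[OF split, of set] arg_cong[OF split, of distinct] by auto
  have a_in: "a \<in> {1..n}" unfolding a_def
    using D n by (metis diff_less nth_mem pos2 order_less_le_trans)
  \<comment> \<open>Makes the exponent \<open>n - a\<close> at least 1, as
    \<open>funpow_\<sigma>\<close> requires.\<close>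
  have a_ne: "a \<noteq> n"
  proof
    assume "a = n"
    then have "A ! (n - 2) = A ! (n - 1)" using D ne by (simp add: a_def last_conv_nth)
    then show False using D n by (auto simp: nth_eq_iff_index_eq)
  qed
  have \<tau>: "\<tau> A = map (shift n (n - a)) ?L"
    unfolding \<tau>_def Let_def D(1) a_def[symmetric]
    by (rule funpow_\<sigma>[OF A n]) (use a_in a_ne in \<open>auto simp: a_def\<close>)
  have m: "n - a < n" using a_in by auto
  have bne: "butlast A \<noteq> []" using D n by (cases A rule: rev_cases) auto
  have "last ?L = butlast A ! (n - 2)" using bne D n by (simp add: last_conv_nth numeral_2_eq_2)
  also have "\<dots> = a" using D n by (simp add: nth_butlast a_def)
  finally have "last (\<tau> A) = n" using a_in bne by (simp add: \<tau> last_map shift_def)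
  moreover have "distinct (\<tau> A)"
    unfolding \<tau> distinct_map using dL sL inj_on_shift[OF m] by simp
  moreover have "set (\<tau> A) = {1..n}"
  proof (rule card_subset_eq)
    show "set (\<tau> A) \<subseteq> {1..n}" unfolding \<tau> set_map sL using shift_in m by fastforce
    show "card (set (\<tau> A)) = card {1..n}"
      using \<open>distinct (\<tau> A)\<close> D n by (simp add: distinct_card) (simp add: \<tau>)
  qed simp
  ultimately show "\<tau> A \<in> perms_max_last n"
    by (auto simp: perms_max_last_def permutations_of_set_def)
  \<comment> \<open>The front entry \<open>n\<close> is the last entry of \<open>A\<close>, so the
    wrap-around at index \<open>n - 1\<close> agrees too.\<close>
  have L: "?L ! (Suc i mod n) = A ! (i mod n)"
  proof (cases "Suc (i mod n) = n")
    case True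
    then have "?L ! (Suc i mod n) = n" by (simp add: mod_Suc)
    also have "\<dots> = A ! (i mod n)" using True D ne
      by (metis diff_Suc_1 last_conv_nth)
    finally show ?thesis .
  next
    case False
    moreover have "i mod n < n" using n by simp
    ultimately have "i mod n < n - 1" by linarith
    then show ?thesis using False D by (simp add: mod_Suc nth_butlast)
  qed
  have lt: "Suc i mod n < length ?L" using D n by simp
  have len: "length (\<tau> A) = n" using D n by (simp add: \<tau>)
  have "cyc_nth (\<tau> A) (Suc i) = shift n (n - a) (?L ! (Suc i mod n))"
    unfolding cyc_nth_def len by (subst \<tau>) (rule nth_map[OF lt])
  then have "cyc_nth (\<tau> A) (Suc i) = shift n (n - a) (cyc_nth A i)"
    unfolding L cyc_nth_def D(1) .
  moreover have "int (n - a) = int n - int a" using a_in by auto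
  ultimately have "[int (cyc_nth (\<tau> A) (Suc i)) = int (cyc_nth A i) + (int n - int a)] (mod int n)"
    using shift_cong[of n "n - a" "cyc_nth A i"] by simp
  moreover have "[int (cyc_nth A i) + (int n - int a) = int (cyc_nth A i) - int a] (mod int n)"
    by (simp add: cong_iff_dvd_diff)
  ultimately show "[int (cyc_nth (\<tau> A) (Suc i)) = int (cyc_nth A i) - int (A ! (n - 2))] (mod int n)"
    unfolding a_def by (rule cong_trans)
qed

text \<open>The rotations compose and the translations add up to a single constant \<open>c\<close>.
  What matters later is that \<open>c\<close> does not depend on \<open>i\<close>.\<close>

lemma funpow_\<tau>:
  assumes A: "A \<in> perms_max_last n" and n: "n \<ge> 2"
  shows "(\<tau> ^^ m) A \<in> perms_max_last n \<and>
    (\<exists>c. \<forall>i. [int (cyc_nth ((\<tau> ^^ m) A) (i + m)) = int (cyc_nth A i) + c] (mod int n))"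
proof (induction m)
  case 0
  show ?case using A by (auto intro!: exI[of _ 0])
next
  case (Suc m)
  let ?B = "(\<tau> ^^ m) A"
  obtain c where B: "?B \<in> perms_max_last n"
    and c: "[int (cyc_nth ?B (i + m)) = int (cyc_nth A i) + c] (mod int n)" for i
    using Suc by blast
  let ?b = "int (?B ! (n - 2))"
  have "[int (cyc_nth (\<tau> ?B) (i + Suc m)) = int (cyc_nth A i) + (c - ?b)] (mod int n)" for i
  proof -
    have "[int (cyc_nth (\<tau> ?B) (Suc (i + m))) = int (cyc_nth ?B (i + m)) - ?b] (mod int n)"
      by (rule cyc_nth_\<tau>[OF B n])
    also have "[int (cyc_nth ?B (i + m)) - ?b = int (cyc_nth A i) + c - ?b] (mod int n)"
      by (intro cong_diff c cong_refl)
    finally show ?thesis by (simp add: algebra_simps)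
  qed
  then show ?case using \<tau>_in_perms_max_last[OF B n] by auto
qed

lemma cyc_nth_in:
  assumes "A \<in> perms_max_last n" "n > 0"
  shows "cyc_nth A i \<in> {1..n}"
  using perms_max_lastD[OF assms(1)] assms(2) by (metis cyc_nth_def mod_less_divisor nth_mem)

lemma eq_if_cong_atLeastAtMost:
  fixes x y n :: nat
  assumes "x \<in> {1..n}" "y \<in> {1..n}" "[int x = int y] (mod int n)"
  shows "x = y"
proof -
  have "int n dvd int x - int y" using assms(3) by (simp add: cong_iff_dvd_diff)
  moreover have "\<bar>int x - int y\<bar> < int n" using assms by auto
  ultimately show ?thesis using zdvd_imp_le[of "int n" "\<bar>int x - int y\<bar>"] by fastforce
qed

text \<open>A rotation by \<open>n\<close> places is the identity, so only a translation remains; it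
  is trivial because both words have \<open>n\<close> at index \<open>n - 1\<close>.\<close>

lemma funpow_\<tau>_period:
  assumes A: "A \<in> perms_max_last n" and n: "n \<ge> 2"
  shows "(\<tau> ^^ n) A = A"
proof -
  let ?B = "(\<tau> ^^ n) A"
  obtain c where B: "?B \<in> perms_max_last n"
    and c: "[int (cyc_nth ?B (i + n)) = int (cyc_nth A i) + c] (mod int n)" for i
    using funpow_\<tau>[OF A n] by blast
  note D = perms_max_lastD[OF A] and E = perms_max_lastD[OF B]
  have ne: "A \<noteq> []" "?B \<noteq> []" using D E n by auto
  have c': "[int (cyc_nth ?B i) = int (cyc_nth A i) + c] (mod int n)" for i
    using c[of i] E(1) by (simp add: cyc_nth_def)
  have "cyc_nth A (n - 1) = n" "cyc_nth ?B (n - 1) = n"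
    using D E ne n by (simp_all add: cyc_nth_def last_conv_nth)
  then have "[c = 0] (mod int n)"
    using c'[of "n - 1"] by (simp add: cong_iff_dvd_diff)
  then have "[int (cyc_nth ?B i) = int (cyc_nth A i)] (mod int n)" for i
    using c'[of i] by (metis add.right_neutral cong_add_lcancel cong_trans)
  then have eq: "cyc_nth ?B i = cyc_nth A i" for i
    using eq_if_cong_atLeastAtMost[OF cyc_nth_in[OF B] cyc_nth_in[OF A]] n by simp
  show ?thesis
  proof (rule nth_equalityI)
    fix i assume "i < length ?B"
    then show "?B ! i = A ! i" using eq[of i] D E by (simp add: cyc_nth_def)
  qed (use D E in simp)
qed

text \<open>The iterates before the first return to \<open>x\<close> are distinct and exhaust the
  orbit, so its size is the return time.\<close>

lemma funpow_card_orbit: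
  assumes "x \<in> orbit f x"
  shows "(f ^^ card (orbit f x)) x = x"
proof -
  let ?m = "funpow_dist1 f x x"
  have "orbit f x = (\<lambda>k. (f ^^ k) x) ` {0..<?m}"
    using assms by (rule orbit_conv_funpow_dist1)
  moreover have "inj_on (\<lambda>k. (f ^^ k) x) {0..<?m}"
    using assms by (rule inj_on_funpow_dist1)
  ultimately have "card (orbit f x) = ?m" by (simp add: card_image)
  then show ?thesis using funpow_dist1_prop[OF assms] by simp
qed

section \<open>Sums of cyclic differences\<close>

text \<open>Cyclically adjacent entries differ, so each of the \<open>n\<close> positions is an
  ascent or a descent; the step from the last entry \<open>n\<close> to the first is a
  descent.\<close>

lemma card_cyclic_descents:
  assumes A: "A \<in> perms_max_last n" and n: "n \<ge> 2"
  shows "card {i \<in> {..<n}. cyc_nth A (Suc i) < cyc_nth A i} = n - ascents A"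
proof -
  note D = perms_max_lastD[OF A]
  let ?asc = "{i. Suc i < length A \<and> A ! i < A ! Suc i}"
  have ne: "A \<noteq> []" using D n by auto
  have "cyc_nth A (Suc i) < cyc_nth A i \<longleftrightarrow> i \<notin> ?asc" if "i < n" for i
  proof (cases "Suc i = n")
    case True
    then have "A ! i = n" using D ne by (metis diff_Suc_1 last_conv_nth)
    moreover have "A ! 0 \<noteq> A ! i" using D n True by (simp add: nth_eq_iff_index_eq)
    moreover have "A ! 0 \<in> {1..n}" using D n by (metis nth_mem length_greater_0_conv ne)
    ultimately show ?thesis using True D by (simp add: cyc_nth_def)
  next
    case False
    then have lt: "Suc i < n" using that by simp
    then have "A ! Suc i \<noteq> A ! i" using D by (simp add: nth_eq_iff_index_eq)
    then show ?thesis using lt D by (auto simp: cyc_nth_def)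
  qed
  then have "{i \<in> {..<n}. cyc_nth A (Suc i) < cyc_nth A i} = {..<n} - ?asc" by auto
  moreover have "?asc \<subseteq> {..<n}" using D by auto
  ultimately show ?thesis
    by (simp add: card_Diff_subset finite_subset[OF _ finite_lessThan] ascents_def)
qed

lemma sum_periodic:
  fixes f :: "nat \<Rightarrow> 'a::comm_semiring_1"
  assumes "\<And>i. f (i + d) = f i"
  shows "(\<Sum>i<m * d. f i) = of_nat m * (\<Sum>i<d. f i)"
proof -
  have f: "f (i + j * d) = f i" for i j
    by (induction j) (use assms in \<open>auto simp: add.assoc[symmetric] add.commute[of d]\<close>)
  have block: "sum f {j * d..<j * d + d} = (\<Sum>i<d. f i)" for j
  proof -
    have "sum f {j * d..<j * d + d} = (\<Sum>i = 0..<d. f (i + j * d))"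
      using sum.shift_bounds_nat_ivl[of f 0 "j * d" d] by (simp add: add.commute)
    then show ?thesis by (simp add: f lessThan_atLeast0)
  qed
  have "(\<Sum>i<m * d. f i) = (\<Sum>j<m. sum f {j * d..<j * d + d})"
    by (rule sum.nat_group[symmetric])
  then show ?thesis by (simp add: block)
qed

lemma gcd_ascents_eq_1_if_period:
  assumes A: "A \<in> perms_max_last n" and n: "n \<ge> 2"
    and d: "d > 0" "d dvd n" and per: "(\<tau> ^^ d) A = A"
  shows "gcd (ascents A) (n div d) = 1"
proof (rule ccontr)
  note D = perms_max_lastD[OF A]
  define k q g B where "k = ascents A" "q = n div d" "g = gcd k q" "B = cyc_nth A"
  assume "gcd (ascents A) (n div d) \<noteq> 1"
  then have g1: "g \<noteq> 1" by (simp add: k_q_g_B_def)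
  \<comment> \<open>The constant \<open>c\<close> of the period cancels in differences, so
    \<open>r\<close> has period \<open>d\<close>.\<close>
  define r where "r i = (int (B (Suc i)) - int (B i)) mod int n" for i
  have q: "q * d = n" using d by (simp add: k_q_g_B_def)
  then have "q > 0" using n by (cases q) auto
  then have "g > 0" by (simp add: k_q_g_B_def)
  with g1 have g: "g > 1" by simp
  have gk: "g dvd k" "g dvd q" by (simp_all add: k_q_g_B_def)
  \<comment> \<open>Chosen so that \<open>j * d\<close> is \<open>n / g\<close>, the distance
    between the two positions that will carry equal entries.\<close>
  define j where "j = q div g"
  have j: "j * g = q" using gk by (simp add: j_def)
  obtain c where c: "[int (B (i + d)) = int (B i) + c] (mod int n)" for i
    using funpow_\<tau>[OF A n, of d] unfolding per k_q_g_B_def by blast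
  have r_per: "r (i + d) = r i" for i
  proof -
    have "[int (B (Suc i + d)) - int (B (i + d)) = (int (B (Suc i)) + c) - (int (B i) + c)] (mod int n)"
      by (intro cong_diff c)
    then show ?thesis by (simp add: r_def cong_def)
  qed
  have tele: "[(\<Sum>i<m. r i) = int (B m) - int (B 0)] (mod int n)" for m
  proof -
    have "[(\<Sum>i<m. r i) = (\<Sum>i<m. int (B (Suc i)) - int (B i))] (mod int n)"
      by (intro cong_sum) (simp add: r_def)
    then show ?thesis using sum_lessThan_telescope[of "\<lambda>i. int (B i)" m] by simp
  qed
  \<comment> \<open>Entries differ by less than \<open>n\<close>, so reduction adds \<open>n\<close>
    exactly at the descents.\<close>
  have r_eq: "r i = int (B (Suc i)) - int (B i) + int n * of_bool (B (Suc i) < B i)" for i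
  proof -
    have "B i \<in> {1..n}" "B (Suc i) \<in> {1..n}" using cyc_nth_in[OF A] n by (auto simp: k_q_g_B_def)
    then show ?thesis
      using mod_add_self2[of "int (B (Suc i)) - int (B i)" "int n"]
        mod_pos_pos_trivial[of "int (B (Suc i)) - int (B i) + int n" "int n"]
      by (cases "B (Suc i) < B i") (auto simp: r_def)
  qed
  have Bn: "B n = B 0" using D by (simp add: k_q_g_B_def cyc_nth_def)
  have "ascents A \<le> card {..<n}"
    unfolding ascents_def by (rule card_mono) (use D in auto)
  then have kn: "k \<le> n" by (simp add: k_q_g_B_def)
  \<comment> \<open>Around the whole cycle the plain differences cancel, leaving \<open>n\<close>
    for each descent.\<close>
  have "(\<Sum>i<n. r i) = int n * (\<Sum>i<n. of_bool (B (Suc i) < B i))"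
    using sum_lessThan_telescope[of "\<lambda>i. int (B i)" n]
    unfolding r_eq sum.distrib by (simp add: Bn sum_distrib_left)
  also have "(\<Sum>i<n. of_bool (B (Suc i) < B i) :: int) = int (card {i \<in> {..<n}. B (Suc i) < B i})"
    by (simp add: of_bool_def sum.If_cases Int_def)
  also have "\<dots> = int n - int k"
    using card_cyclic_descents[OF A n] kn by (simp add: k_q_g_B_def)
  finally have total: "(\<Sum>i<n. r i) = int n * (int n - int k)" .
  define S where "S = (\<Sum>i<d. r i)"
  \<comment> \<open>The total consists of \<open>q\<close> equal periods, and
    \<open>n = q * d\<close>; cancel \<open>q\<close>.\<close>
  have "int q * S = int q * (int d * (int n - int k))"
    using total sum_periodic[of r d q, OF r_per] q by (simp add: S_def flip: of_nat_mult mult.assoc)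
  then have S: "S = int d * (int n - int k)" using \<open>q > 0\<close> by simp
  \<comment> \<open>\<open>g\<close> divides \<open>q\<close>, hence \<open>n\<close>, and it
    divides \<open>k\<close>.\<close>
  have "int g dvd int n - int k"
    using gk q by (metis dvd_diff dvd_mult2 int_dvd_int_iff)
  then obtain u where u: "int n - int k = int g * u" by blast
  have "(\<Sum>i<j * d. r i) = int (j * g * d) * u"
    using sum_periodic[of r d j, OF r_per] by (simp add: S_def[symmetric] S u)
  then have "(\<Sum>i<j * d. r i) = int n * u" using j q by simp
  then have "[int n * u = int (B (j * d)) - int (B 0)] (mod int n)"
    using tele[of "j * d"] by simp
  then have "int n dvd int (B (j * d)) - int (B 0)"
    using cong_dvd_iff by fastforce
  then have "[int (B (j * d)) = int (B 0)] (mod int n)" by (simp add: cong_iff_dvd_diff)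
  then have eq: "B (j * d) = B 0"
    using eq_if_cong_atLeastAtMost[OF cyc_nth_in[OF A] cyc_nth_in[OF A]] n
    unfolding k_q_g_B_def by simp
  \<comment> \<open>\<open>g > 1\<close> gives \<open>j < q\<close>, so the positions 0 and
    \<open>j * d\<close> are distinct, against distinctness of \<open>A\<close>.\<close>
  have "j > 0" using j \<open>q > 0\<close> by (cases j) auto
  moreover have "j < q" using g \<open>q > 0\<close> by (simp add: j_def)
  ultimately have "0 < j * d" "j * d < n" using q d by auto
  then show False
    using eq D by (auto simp: k_q_g_B_def cyc_nth_def nth_eq_iff_index_eq)
qed

section \<open>Excluded orbit sizes\<close>

lemma card_orbit_\<tau>_neq:
  assumes A: "A \<in> canonical_PAPs n k" and n: "n \<ge> 2"
    and d: "d > 0" "d dvd n" "gcd k (n div d) > 1"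
  shows "card (orbit \<tau> A) \<noteq> d"
proof
  assume card: "card (orbit \<tau> A) = d"
  have A': "A \<in> perms_max_last n" "ascents A = k"
    using A by (auto simp: canonical_PAPs_def perms_max_last_def)
  \<comment> \<open>\<open>orbit\<close> collects iterates with positive exponent only, so
    membership rests on the return after \<open>n\<close> steps.\<close>
  have "A \<in> orbit \<tau> A"
    using funpow_\<tau>_period[OF A'(1) n] n by (auto simp: orbit_altdef intro!: exI[of _ n])
  then have "(\<tau> ^^ d) A = A" using funpow_card_orbit card by metis
  then have "gcd k (n div d) = 1"
    using gcd_ascents_eq_1_if_period[OF A'(1) n d(1,2)] A'(2) by simp
  with d(3) show False by simp
qed

theorem theorem5p1:
  fixes n k d :: nat
  assumes "even n" and "n > 0"
    and "1 \<le> k" and "k \<le> n - 1"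
    and "d > 0" and "d dvd n"
    and "gcd k (n div d) > 1"
  shows "\<alpha> n k d = 0 \<and> \<beta> n k d = 0"
proof -
  have n: "n \<ge> 2" using assms(3,4) by simp
  have ne: "card (orbit \<tau> A) \<noteq> d" if "A \<in> canonical_PAPs n k" for A
    using card_orbit_\<tau>_neq[OF that n assms(5-7)] .
  then have "{X \<in> orbit \<tau> ` even_canonical_PAPs n k. card X = d} = {}"
    and "{X \<in> orbit \<tau> ` odd_canonical_PAPs n k. card X = d} = {}"
    by (auto simp: even_canonical_PAPs_def odd_canonical_PAPs_def)
  then show ?thesis by (simp only: \<alpha>_def \<beta>_def card.empty)
qed

end
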